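(* Let $n\geq 3$ be an odd integer and $k\geq 3$ an integer. Then the minimum size of a resolving set of vertices of $(C_n\Box P_k)\Box P_2$ is $3$, i.e. $\beta((C_n\Box P_k)\Box P_2)=3$.
   Context: $C_n$ denotes the cycle on $n$ vertices and $P_k$ the path on $k$ vertices. For graphs $G,H$, the Cartesian product $G\Box H$ has vertex set $V(G)\times V(H)$, with $(g_1,h_1)$ adjacent to $(g_2,h_2)$ iff either $h_1=h_2$ and $g_1g_2\in E(G)$, or $g_1=g_2$ and $h_1h_2\in E(H)$. For a connected graph $G$ and an ordered set $Q=\{q_1,\dots,q_l\}\subseteq V(G)$, $r(x|Q)=(d(x,q_1),\dots,d(x,q_l))$, where $d$ is the shortest-path distance. $Q$ is a resolving set if distinct vertices have distinct representations $r(\cdot|Q)$. $\beta(G)$ (the metric dimension) is the minimum size of a resolving set of $G$. *)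

theory Defs
  imports "Graph_Theory.Graph_Theory"
begin

text \<open>
  A simple undirected graph is a symmetric loop-free digraph without parallel arcs
  (locale \<^locale>\<open>pair_graph\<close>): the edge \<open>uv\<close> is represented by the two arcs \<open>(u, v)\<close> and \<open>(v, u)\<close>.
\<close>

definition cycle_graph :: "nat \<Rightarrow> nat pair_pre_digraph" where
  "cycle_graph n =
    \<lparr> pverts = {..<n},
      parcs = {(i, j). i < n \<and> j < n \<and> (j = (i + 1) mod n \<or> i = (j + 1) mod n)} \<rparr>"

definition path_graph :: "nat \<Rightarrow> nat pair_pre_digraph" where
  "path_graph k =
    \<lparr> pverts = {..<k},
      parcs = {(i, j). i < k \<and> j < k \<and> (j = i + 1 \<or> i = j + 1)} \<rparr>"

definition cartesian_product ::
  "'a pair_pre_digraph \<Rightarrow> 'b pair_pre_digraph \<Rightarrow> ('a \<times> 'b) pair_pre_digraph"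
  (infixl \<open>\<box>\<close> 70) where
  "G \<box> H =
    \<lparr> pverts = pverts G \<times> pverts H,
      parcs = {((g1, h1), (g2, h2)).
        (g1, h1) \<in> pverts G \<times> pverts H \<and> (g2, h2) \<in> pverts G \<times> pverts H \<and>
        (h1 = h2 \<and> (g1, g2) \<in> parcs G \<or> g1 = g2 \<and> (h1, h2) \<in> parcs H)} \<rparr>"

text \<open>
  \<open>wf_digraph.\<mu> G f u v\<close> is the infimum of the \<open>f\<close>-costs of the walks from \<open>u\<close> to \<open>v\<close>;
  with unit weights the cost of a walk is its length.
\<close>

definition graph_dist :: "('a, 'b) pre_digraph \<Rightarrow> 'a \<Rightarrow> 'a \<Rightarrow> ereal" where
  "graph_dist G u v = wf_digraph.\<mu> G (\<lambda>_. 1) u v"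

definition representation :: "('a, 'b) pre_digraph \<Rightarrow> 'a list \<Rightarrow> 'a \<Rightarrow> ereal list" where
  "representation G qs x = map (graph_dist G x) qs"

text \<open>An ordered set of vertices is a list without repetitions; its size is the length.\<close>

definition resolving_set :: "('a, 'b) pre_digraph \<Rightarrow> 'a list \<Rightarrow> bool" where
  "resolving_set G qs \<longleftrightarrow>
    distinct qs \<and> set qs \<subseteq> verts G \<and> inj_on (representation G qs) (verts G)"

definition metric_dimension :: "('a, 'b) pre_digraph \<Rightarrow> nat" where
  "metric_dimension G = (LEAST l. \<exists>qs. resolving_set G qs \<and> length qs = l)"

lemma pair_graph_cycle_graph:
  assumes "n \<ge> 3"
  shows "pair_graph (cycle_graph n)"
proof
  fix e assume "e \<in> parcs (cycle_graph n)"
  then show "fst e \<noteq> snd e"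
    using assms by (auto simp: cycle_graph_def mod_Suc split: if_splits)
qed (auto simp: cycle_graph_def symmetric_def sym_def arcs_ends_def arc_to_ends_def
      intro: finite_subset[of _ "{..<n} \<times> {..<n}"])

lemma pair_graph_path_graph: "pair_graph (path_graph k)"
  by standard (auto simp: path_graph_def symmetric_def sym_def arcs_ends_def arc_to_ends_def
      intro: finite_subset[of _ "{..<k} \<times> {..<k}"])

lemma pair_graph_cartesian_product:
  assumes "pair_graph G" "pair_graph H"
  shows "pair_graph (G \<box> H)"
proof -
  interpret G: pair_graph G by fact
  interpret H: pair_graph H by fact
  have "sym (parcs G)" "sym (parcs H)"
    using G.sym_arcs H.sym_arcs
    by (auto simp: symmetric_def arcs_ends_def arc_to_ends_def)
  then have "sym (parcs (G \<box> H))"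
    by (auto simp: cartesian_product_def sym_def)
  then show ?thesis
    by unfold_locales
      (auto simp: cartesian_product_def symmetric_def arcs_ends_def arc_to_ends_def
        dest: G.no_loops H.no_loops
        intro: finite_subset[of _ "(pverts G \<times> pverts H) \<times> (pverts G \<times> pverts H)"])
qed

end

theory Submission
  imports Defs
begin

text \<open>
  All neighbours of a vertex \<open>a\<close> have distance 1 to \<open>a\<close>, and their distances to a vertex \<open>b\<close>
  differ by at most 1 from the distance between \<open>a\<close> and \<open>b\<close>. So \<open>a\<close> and \<open>b\<close> resolve at most
  three neighbours of \<open>a\<close>, whereas every vertex of the product has at least four.

  For \<open>n = 2 m + 1\<close> the vertices \<open>(0,0,0)\<close>, \<open>(m,0,0)\<close>, \<open>(0,k-1,0)\<close> resolve the product: in the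
  odd cycle the difference of the distances to \<open>0\<close> and \<open>m\<close> determines the vertex \<open>i\<close>, the first
  distance then determines \<open>j + l\<close>, and the third one determines \<open>l - j\<close>.
\<close>

section \<open>Recognising the graph distance by local conditions\<close>

definition distance_function :: "'a pair_pre_digraph \<Rightarrow> ('a \<Rightarrow> 'a \<Rightarrow> nat) \<Rightarrow> bool" where
  "distance_function G d \<longleftrightarrow>
    (\<forall>u \<in> pverts G. \<forall>v \<in> pverts G. d u v = 0 \<longleftrightarrow> u = v) \<and>
    (\<forall>u w v. (u, w) \<in> parcs G \<longrightarrow> v \<in> pverts G \<longrightarrow> d u v \<le> Suc (d w v)) \<and>
    (\<forall>u \<in> pverts G. \<forall>v \<in> pverts G. u \<noteq> v \<longrightarrow> (\<exists>w. (u, w) \<in> parcs G \<and> d u v = Suc (d w v)))"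

text \<open>Along a walk to \<open>v\<close> each arc lowers \<open>d\<close> by at most 1, so every
  walk costs at least \<open>d u v\<close>. Repeatedly taking an arc that lowers \<open>d\<close> by
  exactly 1 builds a walk of that cost. With this, distances are found without handling
  walks.\<close>

lemma graph_dist_eq:
  fixes G :: "'a pair_pre_digraph"
  assumes G: "pair_graph G" and d: "distance_function G d"
    and "u \<in> pverts G" and v: "v \<in> pverts G"
  shows "graph_dist G u v = ereal (real (d u v))"
proof -
  interpret G: pair_graph G by fact
  have lower: "real (d u v) \<le> G.awalk_cost (\<lambda>_. 1) p" if "G.awalk u p v" for u p
    using that
  proof (induction p arbitrary: u)
    case Nil
    then show ?case using d by (auto simp: G.awalk_Nil_iff distance_function_def)
  next
    case (Cons e p)
    then have e: "(u, snd e) \<in> parcs G" and "G.awalk (snd e) p v"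
      by (auto simp: G.awalk_Cons_iff)
    with Cons.IH have "real (d (snd e) v) \<le> G.awalk_cost (\<lambda>_. 1) p" by blast
    moreover have "d u v \<le> Suc (d (snd e) v)"
      using d e v unfolding distance_function_def by blast
    ultimately show ?case by simp
  qed
  have upper: "\<exists>p. G.awalk u p v \<and> G.awalk_cost (\<lambda>_. 1) p = real (d u v)"
    if "u \<in> pverts G" for u
    using that
  proof (induction "d u v" arbitrary: u)
    case 0
    then have "u = v" using d v unfolding distance_function_def by metis
    then show ?case using 0 v by (intro exI[of _ "[]"]) (auto simp: G.awalk_Nil_iff)
  next
    case (Suc x)
    then have "u \<noteq> v" using d unfolding distance_function_def by (metis nat.distinct(1))
    with d Suc.prems v obtain w where w: "(u, w) \<in> parcs G" "d u v = Suc (d w v)"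
      unfolding distance_function_def by blast
    moreover have "w \<in> pverts G" using w(1) by (rule G.in_arcsD2)
    ultimately obtain p where "G.awalk w p v" "G.awalk_cost (\<lambda>_. 1) p = real (d w v)"
      using Suc by auto
    then show ?case using w Suc.prems
      by (intro exI[of _ "(u, w) # p"]) (auto simp: G.awalk_Cons_iff)
  qed
  show ?thesis
    unfolding graph_dist_def
  proof (rule antisym)
    show "G.\<mu> (\<lambda>_. 1) u v \<le> ereal (real (d u v))"
      using upper[OF assms(3)] G.min_cost_le_walk_cost by metis
    show "ereal (real (d u v)) \<le> G.\<mu> (\<lambda>_. 1) u v"
      unfolding G.\<mu>_def by (rule INF_greatest) (simp add: lower)
  qed
qed

text \<open>Transfers resolving from lists of extended reals to values of \<open>d\<close>, so that
  the rest is arithmetic in \<open>nat\<close>.\<close>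

lemma representation_eq_iff:
  fixes G :: "'a pair_pre_digraph"
  assumes "pair_graph G" "distance_function G d" "set qs \<subseteq> pverts G"
    and "x \<in> pverts G" "y \<in> pverts G"
  shows "representation G qs x = representation G qs y \<longleftrightarrow> (\<forall>q \<in> set qs. d x q = d y q)"
  using assms(3)
  by (auto simp: representation_def graph_dist_eq[OF assms(1,2)] assms(4,5) subset_iff)

section \<open>Lower bound from the minimum degree\<close>

lemma resolving_set_length_ge_3:
  fixes G :: "'a pair_pre_digraph"
  assumes G: "pair_graph G" and d: "distance_function G d" and "pverts G \<noteq> {}"
    and deg: "\<And>a. a \<in> pverts G \<Longrightarrow> 4 \<le> card (parcs G `` {a})"
    and qs: "resolving_set G qs"
  shows "3 \<le> length qs"
proof (rule ccontr)
  interpret G: pair_graph G by fact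
  assume "\<not> 3 \<le> length qs"
  then consider "qs = []" | a where "qs = [a]" | a b where "qs = [a, b]"
    by (auto simp: not_le less_Suc_eq numeral_3_eq_3 length_Suc_conv)
  \<comment> \<open>Shorter lists are padded to two vertices, which may coincide; for the empty list
    a vertex exists by nonemptiness.\<close>
  then have "\<exists>a b. a \<in> pverts G \<and> b \<in> pverts G \<and> set qs \<subseteq> {a, b}"
    using qs assms(3) by cases (auto simp: resolving_set_def)
  then obtain a b where a: "a \<in> pverts G" and b: "b \<in> pverts G" and ab: "set qs \<subseteq> {a, b}"
    by blast
  let ?N = "parcs G `` {a}"
  have sym: "(w, a) \<in> parcs G" if "(a, w) \<in> parcs G" for w
    using that G.sym_arcs by (auto simp: symmetric_def sym_def)
  have N: "?N \<subseteq> pverts G" by (auto dest: G.in_arcsD2)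
  have one: "d w a = 1" if w: "w \<in> ?N" for w
  proof -
    \<comment> \<open>The arc condition moves the first argument, so it is applied to the reversed
      arc \<open>(w, a)\<close>.\<close>
    have "d w a \<le> Suc (d a a)" "w \<noteq> a"
      using d w a sym[of w] G.no_loops'[of a] unfolding distance_function_def by auto
    moreover have "d a a = 0" "d w a = 0 \<longleftrightarrow> w = a"
      using d w a N unfolding distance_function_def by auto
    ultimately show ?thesis by simp
  qed
  have "(\<lambda>w. d w b) ` ?N \<subseteq> {d a b - 1, d a b, Suc (d a b)}"
  proof (rule image_subsetI)
    fix w assume "w \<in> ?N"
    then have w: "(a, w) \<in> parcs G" by simp
    have "d a b \<le> Suc (d w b)" "d w b \<le> Suc (d a b)"
      using d w sym[OF w] b unfolding distance_function_def by blast+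
    then have "d w b = d a b - 1 \<or> d w b = d a b \<or> d w b = Suc (d a b)" by linarith
    then show "d w b \<in> {d a b - 1, d a b, Suc (d a b)}" by simp
  qed
  then have "card ((\<lambda>w. d w b) ` ?N) \<le> card {d a b - 1, d a b, Suc (d a b)}"
    by (rule card_mono[rotated]) simp
  \<comment> \<open>Only an inequality: for \<open>a = b\<close> the truncated
    \<open>d a b - 1\<close> coincides with \<open>d a b\<close>.\<close>
  also have "\<dots> \<le> 3" by (simp add: card_insert_if)
  finally have le: "card ((\<lambda>w. d w b) ` ?N) \<le> 3" .
  have "inj_on (\<lambda>w. d w b) ?N"
  proof (rule inj_onI)
    fix x y assume xy: "x \<in> ?N" "y \<in> ?N" "d x b = d y b"
    \<comment> \<open>The distances to \<open>a\<close> agree by \<open>one\<close>, those to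
      \<open>b\<close> by assumption.\<close>
    have "representation G qs x = representation G qs y"
      using qs ab xy N one
      by (subst representation_eq_iff[OF G d]) (auto simp: resolving_set_def)
    with qs xy N show "x = y" by (auto simp: resolving_set_def dest: inj_onD)
  qed
  with le have "card ?N \<le> 3" by (simp add: card_image)
  with deg[OF a] show False by simp
qed

section \<open>Distances and degrees in Cartesian products\<close>

lemma distance_function_cartesian_product:
  assumes "pair_graph G" "pair_graph H"
    and G: "distance_function G d" and H: "distance_function H e"
  shows "distance_function (G \<box> H) (\<lambda>(g, h) (g', h'). d g g' + e h h')"
  unfolding distance_function_def
proof (intro conjI ballI allI impI)
  fix u v assume "u \<in> pverts (G \<box> H)" "v \<in> pverts (G \<box> H)"
  then show "((case u of (g, h) \<Rightarrow> \<lambda>(g', h'). d g g' + e h h') v = 0) = (u = v)"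
    using G H by (auto simp: distance_function_def cartesian_product_def)
next
  fix u w v assume "(u, w) \<in> parcs (G \<box> H)" "v \<in> pverts (G \<box> H)"
  then show "(case u of (g, h) \<Rightarrow> \<lambda>(g', h'). d g g' + e h h') v
      \<le> Suc ((case w of (g, h) \<Rightarrow> \<lambda>(g', h'). d g g' + e h h') v)"
    using G H by (fastforce simp: distance_function_def cartesian_product_def)
next
  interpret wfG: pair_graph G by fact
  interpret wfH: pair_graph H by fact
  fix u v assume uv: "u \<in> pverts (G \<box> H)" "v \<in> pverts (G \<box> H)" "u \<noteq> v"
  obtain g h g' h' where [simp]: "u = (g, h)" "v = (g', h')" by fastforce
  have in_verts: "g \<in> pverts G" "g' \<in> pverts G" "h \<in> pverts H" "h' \<in> pverts H"
    using uv by (auto simp: cartesian_product_def)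
  show "\<exists>w. (u, w) \<in> parcs (G \<box> H) \<and>
      (case u of (g, h) \<Rightarrow> \<lambda>(g', h'). d g g' + e h h') v =
      Suc ((case w of (g, h) \<Rightarrow> \<lambda>(g', h'). d g g' + e h h') v)"
  \<comment> \<open>A step towards \<open>v\<close> is taken in the first coordinate while it
    differs, and otherwise in the second; the other summand is unchanged.\<close>
  proof (cases "g = g'")
    case False
    with G in_verts obtain x where x: "(g, x) \<in> parcs G" "d g g' = Suc (d x g')"
      unfolding distance_function_def by blast
    moreover have "x \<in> pverts G" using x(1) by (rule wfG.in_arcsD2)
    ultimately show ?thesis
      using in_verts by (intro exI[of _ "(x, h)"]) (auto simp: cartesian_product_def)
  next
    case True
    with uv have "h \<noteq> h'" by simp
    with H in_verts obtain x where x: "(h, x) \<in> parcs H" "e h h' = Suc (e x h')"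
      unfolding distance_function_def by blast
    moreover have "x \<in> pverts H" using x(1) by (rule wfH.in_arcsD2)
    ultimately show ?thesis
      using in_verts by (intro exI[of _ "(g, x)"]) (auto simp: cartesian_product_def)
  qed
qed

lemma card_neighbours_cartesian_product:
  assumes G: "pair_graph G" and H: "pair_graph H" and "g \<in> pverts G" "h \<in> pverts H"
  shows "card (parcs (G \<box> H) `` {(g, h)}) = card (parcs G `` {g}) + card (parcs H `` {h})"
proof -
  interpret G: pair_graph G by fact
  interpret H: pair_graph H by fact
  have "parcs (G \<box> H) `` {(g, h)} = (parcs G `` {g}) \<times> {h} \<union> {g} \<times> (parcs H `` {h})"
    using assms(3,4)
    by (auto simp: cartesian_product_def dest: G.in_arcsD2 H.in_arcsD2)
  moreover have "finite (parcs G `` {g})" "finite (parcs H `` {h})"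
    using G.finite_arcs H.finite_arcs by (auto intro: finite_Image)
  \<comment> \<open>A common element could only be \<open>(g, h)\<close>, which would make
    \<open>g\<close> its own neighbour.\<close>
  moreover have "(parcs G `` {g}) \<times> {h} \<inter> {g} \<times> (parcs H `` {h}) = {}"
    using G.no_loops'[of g] by auto
  ultimately show ?thesis by (simp add: card_Un_disjoint card_cartesian_product)
qed

section \<open>Distances in paths and cycles\<close>

definition path_dist :: "nat \<Rightarrow> nat \<Rightarrow> nat" where
  "path_dist i j = (i - j) + (j - i)"

text \<open>The length of the shorter of the two arcs between \<open>i\<close> and \<open>j\<close>;
  \<open>path_dist\<close> is the absolute difference, as one of its truncated summands
  vanishes.\<close>

definition cycle_dist :: "nat \<Rightarrow> nat \<Rightarrow> nat \<Rightarrow> nat" where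
  "cycle_dist n i j = min (path_dist i j) (n - path_dist i j)"

lemma distance_function_path_graph: "distance_function (path_graph k) path_dist"
  unfolding distance_function_def
proof (intro conjI ballI allI impI)
  fix u v assume uv: "u \<in> pverts (path_graph k)" "v \<in> pverts (path_graph k)" "u \<noteq> v"
  then show "\<exists>w. (u, w) \<in> parcs (path_graph k) \<and> path_dist u v = Suc (path_dist w v)"
    by (intro exI[of _ "if u < v then u + 1 else u - 1"])
      (auto simp: path_graph_def path_dist_def)
qed (auto simp: path_graph_def path_dist_def)

text \<open>Without \<open>mod\<close>, adjacency can be handled by linear arithmetic.\<close>

lemma parcs_cycle_graph_iff:
  assumes "n \<ge> 3"
  shows "(i, j) \<in> parcs (cycle_graph n) \<longleftrightarrow>
    i < n \<and> j < n \<and> (j = i + 1 \<or> i = j + 1 \<or> i = 0 \<and> j = n - 1 \<or> j = 0 \<and> i = n - 1)"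
  using assms by (auto simp: cycle_graph_def mod_Suc)

lemma distance_function_cycle_graph:
  assumes n: "n \<ge> 3"
  shows "distance_function (cycle_graph n) (cycle_dist n)"
  unfolding distance_function_def
proof (intro conjI ballI allI impI)
  fix u v assume "u \<in> pverts (cycle_graph n)" "v \<in> pverts (cycle_graph n)"
  then show "cycle_dist n u v = 0 \<longleftrightarrow> u = v"
    by (auto simp: cycle_graph_def cycle_dist_def path_dist_def min_def)
next
  fix u w v assume "(u, w) \<in> parcs (cycle_graph n)" "v \<in> pverts (cycle_graph n)"
  then have "u < n" "w < n" "v < n"
    "w = u + 1 \<or> u = w + 1 \<or> u = 0 \<and> w = n - 1 \<or> w = 0 \<and> u = n - 1"
    using parcs_cycle_graph_iff[OF n] by (auto simp: cycle_graph_def)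
  then show "cycle_dist n u v \<le> Suc (cycle_dist n w v)"
    by (elim disjE; cases u v rule: linorder_cases) (auto simp: cycle_dist_def path_dist_def min_def)
next
  fix u v assume "u \<in> pverts (cycle_graph n)" "v \<in> pverts (cycle_graph n)" "u \<noteq> v"
  then have uv: "u < n" "v < n" "u \<noteq> v" by (auto simp: cycle_graph_def)
  define up where "up = (if u = n - 1 then 0 else u + 1)"
  define down where "down = (if u = 0 then n - 1 else u - 1)"
  \<comment> \<open>The neighbour along a shorter arc: upwards if \<open>v\<close> lies above and
    the direct arc is short, or if \<open>v\<close> lies below and wrapping around through
    \<open>n - 1\<close> is shorter.\<close>
  define w where "w = (if u < v \<longleftrightarrow> 2 * path_dist u v \<le> n then up else down)"
  have "(u, w) \<in> parcs (cycle_graph n)"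
    using uv n by (auto simp: parcs_cycle_graph_iff w_def up_def down_def)
  moreover have "cycle_dist n u v = Suc (cycle_dist n w v)"
  proof (cases "u < v")
    case True
    then show ?thesis
      using uv n by (cases "2 * (v - u) \<le> n"; cases "u = 0")
        (auto simp: cycle_dist_def path_dist_def w_def up_def down_def min_def)
  next
    case False
    then show ?thesis
      using uv n by (cases "2 * (u - v) \<le> n"; cases "u = n - 1")
        (auto simp: cycle_dist_def path_dist_def w_def up_def down_def min_def)
  qed
  ultimately show "\<exists>w. (u, w) \<in> parcs (cycle_graph n) \<and> cycle_dist n u v = Suc (cycle_dist n w v)"
    by blast
qed

text \<open>The shifts \<open>s\<close> and \<open>s'\<close> stand for the path coordinates and
  cancel in the difference of the two distances. As an integer this difference is 2i - m for i \<le>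
  m and 3m + 1 - 2i beyond: injective on each range, and of different parity on the two.\<close>

lemma odd_cycle_resolved:
  assumes i: "i < 2 * m + 1" and i': "i' < 2 * m + 1"
    and eq_0: "cycle_dist (2 * m + 1) i 0 + s = cycle_dist (2 * m + 1) i' 0 + s'"
    and eq_m: "cycle_dist (2 * m + 1) i m + s = cycle_dist (2 * m + 1) i' m + s'"
  shows "i = i'"
proof -
  have dist_0: "cycle_dist (2 * m + 1) a 0 = (if a \<le> m then a else 2 * m + 1 - a)" for a
    by (auto simp: cycle_dist_def path_dist_def)
  have dist_m: "cycle_dist (2 * m + 1) a m = (if a \<le> m then m - a else a - m)"
    if "a < 2 * m + 1" for a
    using that by (auto simp: cycle_dist_def path_dist_def)
  note eqs = eq_0[unfolded dist_0] eq_m[unfolded dist_m[OF i] dist_m[OF i']]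
  \<comment> \<open>The distances to \<open>0\<close> and \<open>m\<close> add up to \<open>m\<close> on one arc and to \<open>m + 1\<close> on the other.\<close>
  consider "i \<le> m" "i' \<le> m" | "m < i" "m < i'" | "i \<le> m" "m < i'" | "m < i" "i' \<le> m"
    by linarith
  then show ?thesis
  proof cases
    case 1
    then show ?thesis using eqs by simp
  next
    case 2
    then show ?thesis using eqs i i' by simp
  next
    case 3
    \<comment> \<open>Adding both equations eliminates the vertices and leaves a contradiction of
      parity.\<close>
    then have "2 * s = 2 * s' + 1" using eqs i' by simp
    then show ?thesis by presburger
  next
    case 4
    then have "2 * s' = 2 * s + 1" using eqs i by simp
    then show ?thesis by presburger
  qed
qed

section \<open>Minimum degrees of cycles and paths\<close>

lemma card_neighbours_cycle_graph:
  assumes "n \<ge> 3" "i < n"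
  shows "2 \<le> card (parcs (cycle_graph n) `` {i})"
proof -
  interpret pair_graph "cycle_graph n" using assms(1) by (rule pair_graph_cycle_graph)
  define up where "up = (if i = n - 1 then 0 else i + 1)"
  define down where "down = (if i = 0 then n - 1 else i - 1)"
  have "{up, down} \<subseteq> parcs (cycle_graph n) `` {i}"
    using assms by (auto simp: parcs_cycle_graph_iff up_def down_def)
  moreover have "finite (parcs (cycle_graph n) `` {i})"
    using finite_arcs by (auto intro: finite_Image)
  ultimately have "card {up, down} \<le> card (parcs (cycle_graph n) `` {i})"
    by (intro card_mono)
  \<comment> \<open>For \<open>n = 2\<close> the two neighbours would coincide.\<close>
  moreover have "up \<noteq> down" using assms by (auto simp: up_def down_def)
  ultimately show ?thesis by simp
qed

lemma card_neighbours_path_graph: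
  assumes "k \<ge> 2" "i < k"
  shows "1 \<le> card (parcs (path_graph k) `` {i})"
proof -
  interpret pair_graph "path_graph k" by (rule pair_graph_path_graph)
  have "(i, if i = 0 then 1 else i - 1) \<in> parcs (path_graph k)"
    using assms by (auto simp: path_graph_def)
  moreover have "finite (parcs (path_graph k) `` {i})"
    using finite_arcs by (auto intro: finite_Image)
  ultimately show ?thesis by (auto simp: Suc_le_eq card_gt_0_iff)
qed

section \<open>The metric dimension of the product\<close>

theorem theorem3p2:
  fixes n k :: nat
  assumes "n \<ge> 3" and "odd n" and "k \<ge> 3"
  shows "metric_dimension ((cycle_graph n \<box> path_graph k) \<box> path_graph 2) = 3"
proof -
  let ?CP = "cycle_graph n \<box> path_graph k"
  let ?G = "?CP \<box> path_graph 2"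
  define d where
    "d = (\<lambda>((i, j), l) ((i', j'), l'). cycle_dist n i i' + path_dist j j' + path_dist l l')"
  have CP: "pair_graph ?CP"
    using assms(1) by (intro pair_graph_cartesian_product pair_graph_cycle_graph pair_graph_path_graph)
  have G: "pair_graph ?G"
    by (intro pair_graph_cartesian_product CP pair_graph_path_graph)
  \<comment> \<open>The flat sum is brought into the nested shape produced by applying the product
    lemma twice.\<close>
  have "d = (\<lambda>(g, h) (g', h').
      (\<lambda>(g, h) (g', h'). cycle_dist n g g' + path_dist h h') g g' + path_dist h h')"
    by (auto simp: d_def fun_eq_iff)
  then have d: "distance_function ?G d"
    by (simp only:) (intro distance_function_cartesian_product distance_function_cycle_graph
      distance_function_path_graph CP
      pair_graph_cycle_graph pair_graph_path_graph assms(1))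
  have verts_factors: "pverts (cycle_graph n) = {..<n}" "pverts (path_graph k') = {..<k'}"
    "pverts ?CP = {..<n} \<times> {..<k}" for k'
    by (simp_all add: cartesian_product_def cycle_graph_def path_graph_def)
  have verts: "pverts ?G = ({..<n} \<times> {..<k}) \<times> {..<2}"
    by (simp add: cartesian_product_def cycle_graph_def path_graph_def)
  \<comment> \<open>The bound is 2 + 1 + 1, attained where both path coordinates are
    endpoints.\<close>
  have deg: "4 \<le> card (parcs ?G `` {a})" if in_G: "a \<in> pverts ?G" for a
  proof -
    obtain i j l where a: "a = ((i, j), l)" "i < n" "j < k" "l < 2"
      using in_G verts by auto
    have "card (parcs ?G `` {a}) = card (parcs (cycle_graph n) `` {i})
        + card (parcs (path_graph k) `` {j}) + card (parcs (path_graph 2) `` {l})"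
      using a verts_factors CP assms(1)
      by (simp add: card_neighbours_cartesian_product pair_graph_cycle_graph pair_graph_path_graph)
    moreover have "2 \<le> card (parcs (cycle_graph n) `` {i})"
      "1 \<le> card (parcs (path_graph k) `` {j})" "1 \<le> card (parcs (path_graph 2) `` {l})"
      using a assms card_neighbours_cycle_graph card_neighbours_path_graph by auto
    ultimately show ?thesis by linarith
  qed
  obtain m where m: "n = 2 * m + 1" using assms(2) by (elim oddE)
  let ?qs = "[((0, 0), 0), ((m, 0), 0), ((0, k - 1), 0)] :: ((nat \<times> nat) \<times> nat) list"
  have subset: "set ?qs \<subseteq> pverts ?G" unfolding verts using assms m by auto
  have "inj_on (representation ?G ?qs) (pverts ?G)"
  proof (rule inj_onI)
    fix x y assume xy: "x \<in> pverts ?G" "y \<in> pverts ?G"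
      and "representation ?G ?qs x = representation ?G ?qs y"
    then have eq: "d x q = d y q" if "q \<in> set ?qs" for q
      using representation_eq_iff[OF G d subset] that by blast
    obtain i j l i' j' l' where [simp]: "x = ((i, j), l)" "y = ((i', j'), l')"
      by (metis surj_pair)
    have bounds: "i < n" "j < k" "l < 2" "i' < n" "j' < k" "l' < 2"
      using xy by (auto simp: verts)
    \<comment> \<open>The third vertex sits at the far end of the long path, which reverses the sign
      of \<open>j\<close> and keeps that of \<open>l\<close>.\<close>
    have eqs: "cycle_dist n i 0 + j + l = cycle_dist n i' 0 + j' + l'"
      "cycle_dist n i m + j + l = cycle_dist n i' m + j' + l'"
      "cycle_dist n i 0 + (k - 1 - j) + l = cycle_dist n i' 0 + (k - 1 - j') + l'"
      using eq[of "((0, 0), 0)"] eq[of "((m, 0), 0)"] eq[of "((0, k - 1), 0)"] bounds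
      by (auto simp: d_def path_dist_def)
    have "i = i'"
      using bounds(1,4) eqs(1,2) unfolding m
      by (intro odd_cycle_resolved[of i m i' "j + l" "j' + l'"]) simp_all
    \<comment> \<open>With the cycle terms cancelled, the first and third equations fix j + l and l
      - j; \<open>j < k\<close> makes the truncated \<open>k - 1 - j\<close> exact.\<close>
    moreover from this eqs bounds have "j = j'" by linarith
    moreover from calculation eqs have "l = l'" by simp
    ultimately show "x = y" by simp
  qed
  then have "resolving_set ?G ?qs"
    \<comment> \<open>The three vertices are distinct because \<open>m\<close> and
      \<open>k - 1\<close> are nonzero.\<close>
    using subset assms m by (auto simp: resolving_set_def)
  then have "\<exists>qs. resolving_set ?G qs \<and> length qs = 3"
    by (intro exI[of _ ?qs]) simp
  moreover have "3 \<le> length qs" if "resolving_set ?G qs" for qs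
  proof (rule resolving_set_length_ge_3[OF G d _ deg that])
    show "pverts ?G \<noteq> {}" using subset by (metis empty_iff insert_subset list.set(2))
  qed
  ultimately show ?thesis
    unfolding metric_dimension_def by (intro Least_equality) auto
qed

end
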